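(* Let $\beta\in\mathbb{N}_0$, $\alpha>-1$ and $M>0$. The Jacobi-type orthogonal polynomials $y_n(x)=P_n^{\alpha,\beta,M,0}(x)=P_n^{\alpha,\beta}(x)+MQ_n^{\alpha,\beta}(x)$, $n\in\mathbb{N}_0$, satisfy the linear differential equation of order $2\beta+4$ $$M\big\{\widetilde{L}_{2\beta+4,x}^{\beta,\alpha}-\Lambda_{2\beta+4,n}^{\beta,\alpha}\big\}y_n(x)+C_{\beta,\alpha}\big\{L_{2,x}^{\alpha,\beta}-\Lambda_{2,n}^{\alpha,\beta}\big\}y_n(x)=0,\qquad -1<x<1,$$ where $$\widetilde{L}_{2\beta+4,x}^{\beta,\alpha}y_n(x)=\frac{x+1}{(x-1)^{\alpha}}\,D_x^{\beta+2}\Big\{(x-1)^{\alpha+\beta+2}D_x^{\beta+2}\big[(x+1)^{\beta+1}y_n(x)\big]\Big\}.$$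
   Context: $\mathbb{N}=\{1,2,\dots\}$, $\mathbb{N}_0=\{0,1,2,\dots\}$; $(a)_k=a(a+1)\cdots(a+k-1)$, $(a)_0=1$; $D_x^i$ is $i$-fold differentiation with respect to $x$. The classical Jacobi polynomials are $P_n^{\alpha,\beta}(x)=\frac{(\alpha+1)_n}{n!}\,{}_2F_1\big(-n,n+\alpha+\beta+1;\alpha+1;\frac{1-x}{2}\big)$. Put $Q_0^{\alpha,\beta}(x)=0$ and, for $n\in\mathbb{N}$, $Q_n^{\alpha,\beta}(x)=A_n^{\beta,\alpha}(x+1)P_{n-1}^{\alpha,\beta+2}(x)$ with $A_n^{\beta,\alpha}=\dfrac{(\beta+2)_{n-1}(\alpha+\beta+2)_n}{2\,n!\,(\alpha+1)_{n-1}}$. Further, $\Lambda_{2\beta+4,n}^{\beta,\alpha}=(n)_{\beta+2}(n+\alpha)_{\beta+2}$, $C_{\beta,\alpha}=(\beta+2)!\,(\alpha+1)_{\beta+1}$, $\Lambda_{2,n}^{\alpha,\beta}=n(n+\alpha+\beta+1)$, and $$L_{2,x}^{\alpha,\beta}y(x)=\big\{(x^2-1)D_x^2+[\alpha-\beta+(\alpha+\beta+2)x]D_x\big\}y(x).$$ When $\alpha$ is not an integer, the powers $(x-1)^{\alpha}$ and $(x-1)^{\alpha+\beta+2}$ on $-1<x<1$ are taken with the same fixed branch, so that $(x-1)^{\alpha+\beta+2}=(x-1)^{\alpha}(x-1)^{\beta+2}$; equivalently, $(x-1)^{-\alpha}D_x^{\beta+2}\{(x-1)^{\alpha+\beta+2}\,\cdot\,\}=(-1)^{\beta}(1-x)^{-\alpha}D_x^{\beta+2}\{(1-x)^{\alpha+\beta+2}\,\cdot\,\}$.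 *)

theory Defs
  imports "HOL-Analysis.Analysis"
begin

text \<open>The \<open>i\<close>-fold derivative with respect to a real variable.  The operator below mixes
  real-valued and complex-valued functions of a real variable, hence the vector derivative.\<close>

definition Dx :: "nat \<Rightarrow> (real \<Rightarrow> 'a::real_normed_vector) \<Rightarrow> real \<Rightarrow> 'a" where
  "Dx i f = ((\<lambda>g t. vector_derivative g (at t)) ^^ i) f"

definition smooth_fun_on :: "real set \<Rightarrow> (real \<Rightarrow> real) \<Rightarrow> bool" where
  "smooth_fun_on S y \<longleftrightarrow> (\<forall>i. \<forall>x\<in>S. Dx i y differentiable (at x))"

text \<open>Used for open \<open>S\<close>: a linear differential operator with real coefficient functions whose
  leading coefficient has no zero in \<open>S\<close>.  The values are complex because the operator of order
  \<open>2 * \<beta> + 4\<close> below is written with complex powers.\<close>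

definition linear_diff_op_of_order ::
    "nat \<Rightarrow> real set \<Rightarrow> ((real \<Rightarrow> real) \<Rightarrow> real \<Rightarrow> complex) \<Rightarrow> bool" where
  "linear_diff_op_of_order m S T \<longleftrightarrow>
     (\<exists>a :: nat \<Rightarrow> real \<Rightarrow> real.
        (\<forall>x\<in>S. a m x \<noteq> 0) \<and>
        (\<forall>y. smooth_fun_on S y \<longrightarrow>
           (\<forall>x\<in>S. T y x = complex_of_real (\<Sum>i\<le>m. a i x * Dx i y x))))"

text \<open>The hypergeometric series is terminating here, since its first parameter is \<open>- n\<close>.\<close>

definition jacobi_P :: "nat \<Rightarrow> real \<Rightarrow> real \<Rightarrow> real \<Rightarrow> real" where
  "jacobi_P n \<alpha> \<beta> x =
     pochhammer (\<alpha> + 1) n / fact n *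
     eval_fps (fps_hypergeo [- real n, real n + \<alpha> + \<beta> + 1] [\<alpha> + 1] 1) ((1 - x) / 2)"

text \<open>The constant \<open>A_n^{\<beta>,\<alpha>}\<close> (note the order of the parameters), for \<open>n \<ge> 1\<close>.\<close>

definition jacobi_A :: "nat \<Rightarrow> real \<Rightarrow> real \<Rightarrow> real" where
  "jacobi_A n \<beta> \<alpha> =
     pochhammer (\<beta> + 2) (n - 1) * pochhammer (\<alpha> + \<beta> + 2) n /
     (2 * fact n * pochhammer (\<alpha> + 1) (n - 1))"

definition jacobi_Q :: "nat \<Rightarrow> real \<Rightarrow> real \<Rightarrow> real \<Rightarrow> real" where
  "jacobi_Q n \<alpha> \<beta> x =
     (if n = 0 then 0 else jacobi_A n \<beta> \<alpha> * (x + 1) * jacobi_P (n - 1) \<alpha> (\<beta> + 2) x)"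

text \<open>The polynomials \<open>P_n^{\<alpha>,\<beta>,M,0}\<close>.\<close>

definition jacobi_type :: "nat \<Rightarrow> real \<Rightarrow> real \<Rightarrow> real \<Rightarrow> real \<Rightarrow> real" where
  "jacobi_type n \<alpha> \<beta> M x = jacobi_P n \<alpha> \<beta> x + M * jacobi_Q n \<alpha> \<beta> x"

definition eigval_high :: "nat \<Rightarrow> real \<Rightarrow> nat \<Rightarrow> real" where
  "eigval_high \<beta> \<alpha> n = pochhammer (real n) (\<beta> + 2) * pochhammer (real n + \<alpha>) (\<beta> + 2)"

definition C_const :: "nat \<Rightarrow> real \<Rightarrow> real" where
  "C_const \<beta> \<alpha> = fact (\<beta> + 2) * pochhammer (\<alpha> + 1) (\<beta> + 1)"

definition eigval_2 :: "real \<Rightarrow> real \<Rightarrow> nat \<Rightarrow> real" where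
  "eigval_2 \<alpha> \<beta> n = real n * (real n + \<alpha> + \<beta> + 1)"

definition L2_op :: "real \<Rightarrow> real \<Rightarrow> (real \<Rightarrow> real) \<Rightarrow> real \<Rightarrow> real" where
  "L2_op \<alpha> \<beta> y x =
     (x\<^sup>2 - 1) * Dx 2 y x + (\<alpha> - \<beta> + (\<alpha> + \<beta> + 2) * x) * Dx 1 y x"

text \<open>For \<open>z \<noteq> 0\<close>: the branches of the power \<open>z\<^sup>a\<close>, one for every integer \<open>k\<close>; \<open>k = 0\<close> is the
  principal branch \<open>of_real z powr of_real a\<close>.  For fixed \<open>k\<close> the logarithm is fixed, so the
  exponents add up, and for an integer \<open>a\<close> all branches coincide.\<close>

definition branch_powr :: "int \<Rightarrow> real \<Rightarrow> real \<Rightarrow> complex" where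
  "branch_powr k z a =
     exp (complex_of_real a * (Ln (complex_of_real z) + 2 * of_real pi * of_int k * \<i>))"

definition L_high_op :: "int \<Rightarrow> nat \<Rightarrow> real \<Rightarrow> (real \<Rightarrow> real) \<Rightarrow> real \<Rightarrow> complex" where
  "L_high_op k \<beta> \<alpha> y x =
     complex_of_real (x + 1) / branch_powr k (x - 1) \<alpha> *
     Dx (\<beta> + 2)
       (\<lambda>t. branch_powr k (t - 1) (\<alpha> + real \<beta> + 2) *
            complex_of_real (Dx (\<beta> + 2) (\<lambda>s. (s + 1) ^ (\<beta> + 1) * y s) t)) x"

end

theory Submission
  imports Defs
begin

text \<open>In the variable \<open>z = (1 - x) / 2\<close> and with \<open>s = \<alpha> + \<beta> + 1\<close>, the polynomial \<open>P\<^sub>n\<close> is a constant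
  multiple of \<open>F = F(- n, n + s; \<alpha> + 1; z)\<close> and \<open>Q\<^sub>n\<close> a constant multiple of \<open>(1 - z) * G\<close> with
  \<open>G = F(1 - n, n + s + 1; \<alpha> + 1; z)\<close>.  The high-order operator becomes \<open>(-1) ^ \<beta>\<close> times
  \<open>(1 - z) * T ((1 - z) ^ (\<beta> + 1) * y)\<close> where \<open>T p = z powr (- \<alpha>) * D\<^sup>m (z powr (\<alpha> + m) * D\<^sup>m p)\<close> and
  \<open>m = \<beta> + 2\<close>; the branch of the complex power leaves no other trace than this sign.

  The operator \<open>T\<close> sends a monomial to a monomial and a hypergeometric series to a hypergeometric
  series with shifted parameters (\<open>double_deriv_hyp_poly\<close>).  The factor \<open>(1 - z) ^ (\<beta> + 1)\<close> is handled
  by Euler's transformation: \<open>(1 - z) ^ (\<beta> + 2) * G\<close> and \<open>(1 - z) ^ \<beta> * F\<close> are themselves hypergeometric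
  polynomials (\<open>euler_transformation\<close>).  For \<open>Q\<^sub>n\<close> this absorbs every factor and \<open>Q\<^sub>n\<close> is an
  eigenfunction (\<open>double_deriv_WG\<close>).  For \<open>P\<^sub>n\<close> one factor is left, and \<open>P\<^sub>n\<close> is an eigenfunction only up
  to a multiple of \<open>(\<theta> - n) (\<theta> + n + s) F\<close>, where \<open>\<theta> = z D\<close> (\<open>coeff_W_double_deriv_F\<close>).  But \<open>(1 - z) * G\<close>
  is a combination of \<open>F\<close> and \<open>\<theta> F\<close>, and so the Jacobi operator applied to \<open>Q\<^sub>n\<close> gives a multiple of the
  same polynomial (\<open>coeff_hyp_op_WG\<close>).  With the constants \<open>A\<^sub>n\<close> and \<open>C\<close> the two multiples cancel
  (\<open>connection_constants\<close>), which is the term linear in \<open>M\<close>; the terms with \<open>M\<^sup>0\<close> and \<open>M\<^sup>2\<close> are the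
  equations for \<open>P\<^sub>n\<close> and \<open>Q\<^sub>n\<close> alone.

  That the order is \<open>2 * \<beta> + 4\<close> follows by tracing the leading coefficient: multiplication by a function
  multiplies it, differentiation keeps it, and the result \<open>(1 - x\<^sup>2)\<close> to the power \<open>\<beta> + 2\<close>, times
  \<open>M\<close> and a sign, has no zero inside the interval.  The Jacobi operator has lower order
  and does not interfere.\<close>

section \<open>Hypergeometric polynomials and Euler's transformation\<close>

text \<open>A Gauss hypergeometric series \<open>F(- N, b; c; z)\<close> whose first parameter stops it at degree \<open>N\<close>.
  As a polynomial its derivatives, products and coefficients are available without any
  question of convergence.\<close>

definition hyp_poly :: "nat \<Rightarrow> real \<Rightarrow> real \<Rightarrow> real poly" where
  "hyp_poly N b c =
     (\<Sum>j\<le>N. monom (pochhammer (- real N) j * pochhammer b j / (pochhammer c j * fact j)) j)"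

lemma coeff_hyp_poly:
  "coeff (hyp_poly N b c) j = pochhammer (- real N) j * pochhammer b j / (pochhammer c j * fact j)"
proof (cases "j \<le> N")
  case True
  then show ?thesis by (simp add: hyp_poly_def coeff_sum)
next
  case False
  then show ?thesis by (simp add: hyp_poly_def coeff_sum pochhammer_of_nat_eq_0_lemma)
qed

lemma coeff_hyp_poly_Suc:
  assumes "c > 0"
  shows "(c + real j) * (real j + 1) * coeff (hyp_poly N b c) (Suc j) =
         (real j - real N) * (real j + b) * coeff (hyp_poly N b c) j"
proof -
  have "c + real j > 0" "pochhammer c j > 0"
    using assms by (auto intro: pochhammer_pos)
  then show ?thesis
    by (simp add: coeff_hyp_poly pochhammer_Suc divide_simps) (simp add: algebra_simps)
qed

text \<open>The two-term recurrence is how a polynomial is recognised as hypergeometric when its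
  coefficients are not known in closed form, as after Euler's transformation.\<close>

lemma hyp_poly_unique:
  assumes "c > 0" "coeff p 0 = 1"
    and rec: "\<And>j. (c + real j) * (real j + 1) * coeff p (Suc j) = (real j - real N) * (real j + b) * coeff p j"
  shows "p = hyp_poly N b c"
proof (rule poly_eqI)
  fix j
  show "coeff p j = coeff (hyp_poly N b c) j"
  proof (induction j)
    case 0
    then show ?case using assms by (simp add: coeff_hyp_poly)
  next
    case (Suc j)
    have "(c + real j) * (real j + 1) \<noteq> 0" using \<open>c > 0\<close> by (auto simp: add_eq_0_iff)
    then show ?case
      using rec[of j] coeff_hyp_poly_Suc[OF \<open>c > 0\<close>, of j N b] Suc by (metis mult_left_cancel)
  qed
qed

text \<open>In the variable \<open>z = (1 - x) / 2\<close> the factor \<open>x + 1\<close> is \<open>2 * (1 - z)\<close>, so \<open>W\<close> is half of it.\<close>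

definition W :: "real poly" where "W = [:1, -1:]"

lemma poly_W [simp]: "poly W x = 1 - x"
  and pderiv_W: "pderiv W = - 1"
  and W_neq_0 [simp]: "W \<noteq> 0"
  by (simp_all add: W_def pderiv_pCons one_pCons)

lemma coeff_W_mult_0 [simp]: "coeff (W * p) 0 = coeff p 0"
  and coeff_W_mult_Suc [simp]: "coeff (W * p) (Suc j) = coeff p (Suc j) - coeff p j"
  by (simp_all add: W_def mult_pCons_left)

text \<open>Gauss's operator \<open>z (1 - z) D\<^sup>2 + (c - (a + b + 1) z) D - a b\<close>.\<close>

definition hyp_op :: "real \<Rightarrow> real \<Rightarrow> real \<Rightarrow> real poly \<Rightarrow> real poly" where
  "hyp_op a b c p =
     pCons 0 (W * pderiv (pderiv p)) + [:c, - (a + b + 1):] * pderiv p - smult (a * b) p"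

text \<open>Since \<open>hyp_op\<close> combines only two neighbouring coefficients, its kernel is
  given by a two-term recurrence, the one of \<open>hyp_poly\<close> when \<open>a = - N\<close>.\<close>

lemma coeff_hyp_op:
  "coeff (hyp_op a b c p) j =
     (c + real j) * (real j + 1) * coeff p (Suc j) - (real j + a) * (real j + b) * coeff p j"
proof (cases j)
  case 0
  then show ?thesis by (simp add: hyp_op_def coeff_pderiv mult_pCons_left)
next
  case (Suc i)
  then show ?thesis
    by (cases i; simp add: hyp_op_def coeff_pderiv mult_pCons_left; simp add: algebra_simps)
qed

lemma hyp_op_hyp_poly: "c > 0 \<Longrightarrow> hyp_op (- real N) b c (hyp_poly N b c) = 0"
  by (rule poly_eqI) (simp add: coeff_hyp_op coeff_hyp_poly_Suc)

text \<open>The exponents of Gauss's equation at \<open>z = 1\<close> are \<open>0\<close> and \<open>c - a - b\<close>.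
  Multiplication by \<open>(1 - z)\<close> to the power \<open>a + b - c\<close> interchanges them, up to sign, and fixes
  the exponents at \<open>0\<close>; this is why the new parameters are \<open>c - a\<close> and \<open>c - b\<close>.  It is Euler's
  transformation on the level of operators.\<close>

lemma hyp_op_W_power_mult:
  assumes k: "real k = a + b - c"
  shows "hyp_op (c - a) (c - b) c (W ^ k * p) = W ^ k * hyp_op a b c p"
proof -
  define u where "u = W ^ k"
  have u1: "W * pderiv u = smult (- real k) u"
  proof (cases k)
    case (Suc i)
    show ?thesis
      unfolding u_def Suc pderiv_power_Suc
      by (rule poly_ext) (simp add: pderiv_W algebra_simps)
  qed (simp add: u_def)
  then have "pderiv (W * pderiv u) = smult (- real k) (pderiv u)"
    by (simp add: pderiv_smult pderiv_minus)
  then have u2: "W * pderiv (pderiv u) = smult (1 - real k) (pderiv u)"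
    by (simp add: pderiv_mult pderiv_W algebra_simps smult_diff_left)
  \<comment> \<open>The derivatives of \<open>u\<close> are controlled only after multiplication by \<open>W\<close>, so \<open>W\<^sup>2\<close> is carried along and cancelled at the end.\<close>
  have "W ^ 2 * hyp_op (c - a) (c - b) c (u * p) = W ^ 2 * (u * hyp_op a b c p)"
  proof (rule poly_ext)
    fix x :: real
    define w where "w = 1 - x"
    have x: "x = 1 - w" unfolding w_def by simp
    define v v1 v2 q q1 q2 where "v = poly u x" "v1 = poly (pderiv u) x"
      "v2 = poly (pderiv (pderiv u)) x" "q = poly p x" "q1 = poly (pderiv p) x"
      "q2 = poly (pderiv (pderiv p)) x"
    note defs = this
    have W: "poly W x = w" by (simp add: w_def)
    have 1: "w * v1 = - (a + b - c) * v"
      using arg_cong[OF u1, of "\<lambda>p. poly p x"] k by (simp add: defs w_def)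
    have 2: "w * v2 = (1 - (a + b - c)) * v1"
      using arg_cong[OF u2, of "\<lambda>p. poly p x"] k by (simp add: defs w_def)
    have "poly (hyp_op (c - a) (c - b) c (u * p)) x =
      x * w * (v2 * q + 2 * v1 * q1 + v * q2) + (c - (2 * c - a - b + 1) * x) * (v1 * q + v * q1)
       - (c - a) * (c - b) * v * q"
      by (simp add: hyp_op_def pderiv_mult pderiv_add defs w_def algebra_simps)
    moreover have "poly (hyp_op a b c p) x =
      x * w * q2 + (c - (a + b + 1) * x) * q1 - a * b * q"
      by (simp add: hyp_op_def defs w_def algebra_simps)
    moreover have "w\<^sup>2 * (x * w * (v2 * q + 2 * v1 * q1 + v * q2) +
        (c - (2 * c - a - b + 1) * x) * (v1 * q + v * q1) - (c - a) * (c - b) * v * q)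
       = w\<^sup>2 * (v * (x * w * q2 + (c - (a + b + 1) * x) * q1 - a * b * q))"
      unfolding x using 1 2 by algebra
    ultimately show "poly (W ^ 2 * hyp_op (c - a) (c - b) c (u * p)) x =
        poly (W ^ 2 * (u * hyp_op a b c p)) x"
      by (simp only: poly_mult poly_power W defs(1))
  qed
  then show ?thesis by (simp add: u_def)
qed

text \<open>By the previous lemma the product is annihilated by Gauss's operator with parameters
  \<open>c + N\<close> and \<open>c - b = - (N + k)\<close>, hence satisfies the recurrence that characterises the
  right-hand side.\<close>

lemma euler_transformation:
  assumes "c > 0" and k: "b = real N + c + real k"
  shows "W ^ k * hyp_poly N b c = hyp_poly (N + k) (c + real N) c"
proof (rule hyp_poly_unique)
  fix j
  let ?p = "W ^ k * hyp_poly N b c"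
  have "hyp_op (c + real N) (c - b) c ?p = 0"
    using hyp_op_W_power_mult[of k "- real N" b c "hyp_poly N b c"] hyp_op_hyp_poly[OF \<open>c > 0\<close>] k
    by simp
  then have "coeff (hyp_op (c + real N) (c - b) c ?p) j = 0" by simp
  then show "(c + real j) * (real j + 1) * coeff ?p (Suc j) =
        (real j - real (N + k)) * (real j + (c + real N)) * coeff ?p j"
    by (simp add: coeff_hyp_op k algebra_simps)
qed (use assms in \<open>simp_all add: coeff_mult_0 coeff_0_power W_def coeff_hyp_poly\<close>)

section \<open>Weighted derivatives of hypergeometric polynomials\<close>

text \<open>For \<open>z > 0\<close> the polynomial \<open>weighted_deriv i a p\<close> is \<open>z powr (i - a) * D\<^sup>i (z powr a * p)\<close>, since
  \<open>D (z powr b * q) = z powr (b - 1) * (b * q + z * q')\<close>.\<close>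

fun weighted_deriv :: "nat \<Rightarrow> real \<Rightarrow> real poly \<Rightarrow> real poly" where
  "weighted_deriv 0 a p = p"
| "weighted_deriv (Suc i) a p =
     smult (a - real i) (weighted_deriv i a p) + pCons 0 (pderiv (weighted_deriv i a p))"

lemma coeff_weighted_deriv:
  "coeff (weighted_deriv i a p) j = pochhammer (a + real j - real i + 1) i * coeff p j"
proof (induction i)
  case (Suc i)
  have "coeff (weighted_deriv (Suc i) a p) j = (a - real i + real j) * coeff (weighted_deriv i a p) j"
    by (cases j) (simp_all add: coeff_pderiv algebra_simps)
  then show ?case by (simp add: Suc pochhammer_rec algebra_simps)
qed simp

text \<open>This is \<open>z powr (- \<alpha>) * D\<^sup>m (z powr (\<alpha> + m) * D\<^sup>m p)\<close>, the core of the operator of order \<open>2 * m\<close>.\<close>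

definition double_deriv :: "nat \<Rightarrow> real \<Rightarrow> real poly \<Rightarrow> real poly" where
  "double_deriv m \<alpha> p = weighted_deriv m (\<alpha> + real m) ((pderiv ^^ m) p)"

text \<open>The powers of \<open>z\<close> in front and inside cancel the second half of the derivatives, so the
  coefficient sequence is shifted by only \<open>m\<close> places and multiplied by two Pochhammer symbols.
  These are exactly the factors that a shift of a hypergeometric coefficient needs.\<close>

lemma coeff_double_deriv:
  "coeff (double_deriv m \<alpha> p) i =
     pochhammer (real i + 1) m * pochhammer (\<alpha> + 1 + real i) m * coeff p (i + m)"
  by (simp add: double_deriv_def coeff_weighted_deriv coeff_higher_pderiv algebra_simps)

lemma double_deriv_add: "double_deriv m \<alpha> (p + q) = double_deriv m \<alpha> p + double_deriv m \<alpha> q"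
  and double_deriv_smult: "double_deriv m \<alpha> (smult c p) = smult c (double_deriv m \<alpha> p)"
  by (auto intro!: poly_eqI simp: coeff_double_deriv algebra_simps)

lemma hyp_op_add: "hyp_op a b c (p + q) = hyp_op a b c p + hyp_op a b c q"
  and hyp_op_smult: "hyp_op a b c (smult d p) = smult d (hyp_op a b c p)"
  by (auto intro!: poly_eqI simp: coeff_hyp_op algebra_simps)

text \<open>The quotient of the coefficients of index \<open>i + k\<close> and \<open>i\<close> of a hypergeometric series splits by
  \<open>(a)\<^sub>i\<^sub>+\<^sub>k = (a)\<^sub>k * (a + k)\<^sub>i\<close>; the denominators \<open>(c)\<^sub>i\<^sub>+\<^sub>k\<close> and \<open>(i + k)!\<close> are undone by the
  Pochhammer symbols on the left.\<close>

lemma coeff_hyp_poly_shift: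
  assumes "c > 0"
  shows "pochhammer (real i + 1) k * pochhammer (c + real i) k * coeff (hyp_poly (N + k) b c) (i + k)
    = pochhammer (- real (N + k)) k * pochhammer b k * coeff (hyp_poly N (b + real k) c) i"
proof -
  have pos: "pochhammer c i > 0" "pochhammer (c + real i) k > 0" "pochhammer (1 + real i) k > 0"
    using assms by (auto intro!: pochhammer_pos)
  have f: "fact (i + k) = fact i * pochhammer (1 + real i) k"
    unfolding pochhammer_fact by (simp add: pochhammer_product' add.commute)
  have s: "pochhammer z (i + k) = pochhammer z k * pochhammer (z + real k) i" for z :: real
    by (subst add.commute) (rule pochhammer_product')
  show ?thesis
    using pos by (simp add: coeff_hyp_poly s[of b] s[of "- real N - real k"] f pochhammer_product'[of c]
       divide_simps add.commute)
qed

lemma double_deriv_hyp_poly: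
  assumes "\<alpha> > -1"
  shows "double_deriv k \<alpha> (hyp_poly (N + k) b (\<alpha> + 1)) =
     smult (pochhammer (- real (N + k)) k * pochhammer b k) (hyp_poly N (b + real k) (\<alpha> + 1))"
  using coeff_hyp_poly_shift[of "\<alpha> + 1" _ k N b] assms
  by (intro poly_eqI) (simp add: coeff_double_deriv algebra_simps)

text \<open>One of the \<open>k + 1\<close> double differentiations is spent on the factor \<open>W\<close>: it turns the difference of
  two neighbouring coefficients into a multiple of a single one, by the recurrence.  The remaining
  \<open>k\<close> shift the parameters.\<close>

lemma coeff_double_deriv_W_hyp_poly:
  assumes "\<alpha> > -1"
  shows "coeff (double_deriv (Suc k) \<alpha> (W * hyp_poly (N + k) b (\<alpha> + 1))) i =
     pochhammer (- real (N + k)) k * pochhammer b k *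
     ((real i - real N) * (real i + real k + b) - (real i + real k + 1) * (real i + real k + \<alpha> + 1)) *
     coeff (hyp_poly N (b + real k) (\<alpha> + 1)) i"
proof -
  let ?h = "coeff (hyp_poly (N + k) b (\<alpha> + 1))"
  let ?e = "(real i - real N) * (real i + real k + b) - (real i + real k + 1) * (real i + real k + \<alpha> + 1)"
  have "coeff (double_deriv (Suc k) \<alpha> (W * hyp_poly (N + k) b (\<alpha> + 1))) i =
     pochhammer (real i + 1) k * pochhammer (\<alpha> + 1 + real i) k *
     ((\<alpha> + 1 + real (i + k)) * (real (i + k) + 1) * (?h (Suc (i + k)) - ?h (i + k)))"
    by (simp add: coeff_double_deriv pochhammer_Suc algebra_simps)
  also have "(\<alpha> + 1 + real (i + k)) * (real (i + k) + 1) * (?h (Suc (i + k)) - ?h (i + k)) =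
       ?e * ?h (i + k)"
    unfolding right_diff_distrib
    by (subst coeff_hyp_poly_Suc) (use assms in \<open>simp_all add: algebra_simps\<close>)
  finally show ?thesis
    using coeff_hyp_poly_shift[of "\<alpha> + 1" i k N b] assms by (simp add: algebra_simps)
qed

section \<open>Coefficients of the Jacobi-type polynomials\<close>

lemma pochhammer_minus_of_nat_add: "pochhammer (- real (N' + k)) k = (-1) ^ k * pochhammer (real N' + 1) k"
  using pochhammer_minus'[of "real (N' + k)" k] by (simp add: algebra_simps)

lemma pochhammer_shift: "x * pochhammer (x + 1) j = (x + real j) * pochhammer x j"
  by (metis pochhammer_rec pochhammer_rec' mult.commute)

text \<open>The degree is \<open>N = \<nu> + 1\<close>.  Up to constant factors \<open>F\<close> is the Jacobi polynomial of degree \<open>N\<close>, and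
  \<open>W * G\<close> is the polynomial \<open>Q\<close> that \<open>M\<close> multiplies; \<open>\<Lambda>\<^sub>2\<close> is the Jacobi eigenvalue and
  \<open>K * (N + \<beta> + 1) * (N + \<alpha>)\<close> the eigenvalue of order \<open>2 * \<beta> + 4\<close>.  Relations between \<open>F\<close> and \<open>G\<close> are stated
  after multiplication by \<open>\<Lambda>\<^sub>2\<close>, because \<open>\<Lambda>\<^sub>2 * G\<close> has as coefficients those of
  \<open>F\<close> multiplied by a polynomial in the index.\<close>

context
  fixes \<nu> \<beta> :: nat and \<alpha> N s \<Lambda>\<^sub>2 K :: real and F G :: "real poly"
  assumes \<alpha>: "\<alpha> > -1"
  defines "N \<equiv> real (Suc \<nu>)"
  defines "s \<equiv> \<alpha> + real \<beta> + 1"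
  defines "\<Lambda>\<^sub>2 \<equiv> N * (N + s)"
  defines "F \<equiv> hyp_poly (Suc \<nu>) (N + s) (\<alpha> + 1)"
  defines "K \<equiv> pochhammer N (Suc \<beta>) * pochhammer (N + \<alpha> + 1) (Suc \<beta>)"
  defines "G \<equiv> hyp_poly \<nu> (N + s + 1) (\<alpha> + 1)"
begin

lemma F_rec:
  "(\<alpha> + 1 + real j) * (real j + 1) * coeff F (Suc j) = (real j - N) * (real j + N + s) * coeff F j"
  unfolding F_def N_def using coeff_hyp_poly_Suc[of "\<alpha> + 1" j "Suc \<nu>" "real (Suc \<nu>) + s"] \<alpha> by (simp add: algebra_simps)

lemma coeff_G: "\<Lambda>\<^sub>2 * coeff G j = (N - real j) * (N + s + real j) * coeff F j"
proof -
  have 1: "N * pochhammer (- real \<nu>) j = (N - real j) * pochhammer (- N) j"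
    using pochhammer_shift[of "- N" j] by (simp add: N_def algebra_simps)
  have 2: "(N + s) * pochhammer (N + s + 1) j = (N + s + real j) * pochhammer (N + s) j"
    by (rule pochhammer_shift)
  have "\<Lambda>\<^sub>2 * coeff G j = (N * pochhammer (- real \<nu>) j) * ((N + s) * pochhammer (N + s + 1) j)
      / (pochhammer (\<alpha> + 1) j * fact j)"
    by (simp add: \<Lambda>\<^sub>2_def G_def coeff_hyp_poly)
  then show ?thesis
    unfolding 1 2 by (simp add: F_def coeff_hyp_poly N_def)
qed

lemma coeff_G_Suc: "\<Lambda>\<^sub>2 * coeff G j = - (\<alpha> + 1 + real j) * (real j + 1) * coeff F (Suc j)"
  using F_rec[of j] coeff_G[of j] by (simp add: algebra_simps)

text \<open>In terms of \<open>\<theta> = z D\<close> this reads \<open>\<Lambda>\<^sub>2 * (1 - z) * G = (\<Lambda>\<^sub>2 - (\<beta> + 1) * \<theta>) F\<close>.  The right-hand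
  side vanishes at \<open>z = 1\<close> because Gauss's equation prescribes the logarithmic derivative of \<open>F\<close>
  at this singular point.\<close>

lemma coeff_WG: "\<Lambda>\<^sub>2 * coeff (W * G) j = (\<Lambda>\<^sub>2 - (real \<beta> + 1) * real j) * coeff F j"
proof (cases j)
  case 0
  then show ?thesis using coeff_G[of 0] by (simp add: \<Lambda>\<^sub>2_def)
next
  case (Suc i)
  have "\<Lambda>\<^sub>2 * coeff (W * G) j = \<Lambda>\<^sub>2 * coeff G (Suc i) - \<Lambda>\<^sub>2 * coeff G i"
    by (simp add: Suc right_diff_distrib)
  then show ?thesis
    unfolding coeff_G[of "Suc i"] coeff_G_Suc[of i]
    by (simp add: Suc \<Lambda>\<^sub>2_def s_def algebra_simps)
qed

text \<open>Gauss's operator annihilates \<open>F\<close>, so by the formula for \<open>W * G\<close> only its commutator with \<open>\<theta>\<close>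
  contributes.  What is left is a multiple of \<open>(\<theta> - N) (\<theta> + N + s) F\<close>.\<close>

lemma coeff_hyp_op_WG:
  "\<Lambda>\<^sub>2 * coeff (hyp_op (- N) (N + s) (\<alpha> + 1) (W * G)) j =
     - (real \<beta> + 1) * (real j - N) * (real j + N + s) * coeff F j"
proof -
  have "\<Lambda>\<^sub>2 * coeff (hyp_op (- N) (N + s) (\<alpha> + 1) (W * G)) j =
     (\<alpha> + 1 + real j) * (real j + 1) * (\<Lambda>\<^sub>2 * coeff (W * G) (Suc j)) -
     (real j - N) * (real j + N + s) * (\<Lambda>\<^sub>2 * coeff (W * G) j)"
    unfolding coeff_hyp_op by (simp add: algebra_simps)
  also have "\<dots> = (\<Lambda>\<^sub>2 - (real \<beta> + 1) * (real j + 1)) *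
        ((\<alpha> + 1 + real j) * (real j + 1) * coeff F (Suc j)) -
     (real j - N) * (real j + N + s) * (\<Lambda>\<^sub>2 - (real \<beta> + 1) * real j) * coeff F j"
    unfolding coeff_WG by (simp add: algebra_simps)
  also have "\<dots> = - (real \<beta> + 1) * (real j - N) * (real j + N + s) * coeff F j"
    unfolding F_rec by (simp add: algebra_simps)
  finally show ?thesis .
qed

text \<open>Euler's transformation absorbs all but one of the factors \<open>W\<close> into a hypergeometric polynomial
  of degree \<open>N + \<beta>\<close>; the one that is left makes the double derivative a first-order expression
  in \<open>G\<close> instead of a multiple of it.\<close>

lemma coeff_double_deriv_F:
  "coeff (double_deriv (\<beta> + 2) \<alpha> (W ^ (\<beta> + 1) * F)) i =
     (-1) ^ \<beta> * K * ((real \<beta> + 1) * real i + (real \<beta> + 1) * (real \<beta> + 2) + (N + real \<beta> + 1) * (N + \<alpha>)) * coeff G i"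
proof -
  have "W ^ \<beta> * F = hyp_poly (Suc \<nu> + \<beta>) (\<alpha> + 1 + N) (\<alpha> + 1)"
    unfolding F_def N_def by (rule euler_transformation) (use \<alpha> in \<open>simp_all add: s_def\<close>)
  then have WF: "W ^ (\<beta> + 1) * F = W * hyp_poly (\<nu> + Suc \<beta>) (\<alpha> + 1 + N) (\<alpha> + 1)"
    by (simp add: mult.assoc)
  have G: "hyp_poly \<nu> (\<alpha> + 1 + N + real (Suc \<beta>)) (\<alpha> + 1) = G"
    by (simp add: G_def s_def algebra_simps)
  have K: "pochhammer (- real (\<nu> + Suc \<beta>)) (Suc \<beta>) * pochhammer (\<alpha> + 1 + N) (Suc \<beta>) = - ((-1) ^ \<beta> * K)"
    by (subst pochhammer_minus_of_nat_add) (simp add: K_def N_def algebra_simps)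
  have "coeff (double_deriv (\<beta> + 2) \<alpha> (W ^ (\<beta> + 1) * F)) i =
     - ((-1) ^ \<beta> * K) * ((real i - real \<nu>) * (real i + real (Suc \<beta>) + (\<alpha> + 1 + N)) -
       (real i + real (Suc \<beta>) + 1) * (real i + real (Suc \<beta>) + \<alpha> + 1)) * coeff G i"
    using coeff_double_deriv_W_hyp_poly[OF \<alpha>, of "Suc \<beta>" \<nu> "\<alpha> + 1 + N" i]
    unfolding WF G K by (simp only: add_2_eq_Suc')
  also have "(real i - real \<nu>) * (real i + real (Suc \<beta>) + (\<alpha> + 1 + N)) -
       (real i + real (Suc \<beta>) + 1) * (real i + real (Suc \<beta>) + \<alpha> + 1) =
     - ((real \<beta> + 1) * real i + (real \<beta> + 1) * (real \<beta> + 2) + (N + real \<beta> + 1) * (N + \<alpha>))"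
    by (simp add: N_def algebra_simps)
  finally show ?thesis by (simp only: mult_minus_left mult_minus_right minus_minus)
qed

text \<open>Written in the coefficients of \<open>F\<close>, the deviation of \<open>F\<close> from an eigenfunction is a
  multiple of \<open>(\<theta> - N) (\<theta> + N + s) F\<close>, the polynomial which Gauss's operator makes of \<open>W * G\<close>.
  This coincidence is the reason for the differential equation.\<close>

lemma coeff_W_double_deriv_F:
  "\<Lambda>\<^sub>2 * coeff (W * double_deriv (\<beta> + 2) \<alpha> (W ^ (\<beta> + 1) * F)) j =
     (-1) ^ \<beta> * K * (\<Lambda>\<^sub>2 * (N + real \<beta> + 1) * (N + \<alpha>)
       - (real \<beta> + 1) * (real \<beta> + 2) * (real j - N) * (real j + N + s)) * coeff F j"
proof -
  define w where "w = (real \<beta> + 1) * (real \<beta> + 2) + (N + real \<beta> + 1) * (N + \<alpha>)"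
  show ?thesis
  proof (cases j)
    case 0
    have "\<Lambda>\<^sub>2 * coeff (W * double_deriv (\<beta> + 2) \<alpha> (W ^ (\<beta> + 1) * F)) j =
      (-1) ^ \<beta> * K * w * (\<Lambda>\<^sub>2 * coeff G 0)"
      unfolding 0 coeff_W_mult_0 coeff_double_deriv_F by (simp add: w_def)
    also have "\<dots> = (-1) ^ \<beta> * K * (w * (N * (N + s)) * coeff F 0)"
      by (simp add: coeff_G)
    also have "w * (N * (N + s)) = \<Lambda>\<^sub>2 * (N + real \<beta> + 1) * (N + \<alpha>)
       - (real \<beta> + 1) * (real \<beta> + 2) * (real 0 - N) * (real 0 + N + s)"
      unfolding w_def \<Lambda>\<^sub>2_def of_nat_0 by algebra
    finally show ?thesis by (simp add: 0 mult.assoc)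
  next
    case (Suc i)
    have "\<Lambda>\<^sub>2 * coeff (W * double_deriv (\<beta> + 2) \<alpha> (W ^ (\<beta> + 1) * F)) j =
      (-1) ^ \<beta> * K * (((real \<beta> + 1) * (real i + 1) + w) * (\<Lambda>\<^sub>2 * coeff G (Suc i))
        - ((real \<beta> + 1) * real i + w) * (\<Lambda>\<^sub>2 * coeff G i))"
      unfolding Suc coeff_W_mult_Suc coeff_double_deriv_F by (simp add: w_def algebra_simps)
    also have "\<dots> = (-1) ^ \<beta> * K * (
       (((real \<beta> + 1) * (real i + 1) + w) * (N - real (Suc i)) * (N + s + real (Suc i))
        + ((real \<beta> + 1) * real i + w) * (\<alpha> + 1 + real i) * (real i + 1)) * coeff F (Suc i))"
      unfolding coeff_G[of "Suc i"] coeff_G_Suc[of i] by (simp add: algebra_simps)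
    also have "((real \<beta> + 1) * (real i + 1) + w) * (N - real (Suc i)) * (N + s + real (Suc i))
        + ((real \<beta> + 1) * real i + w) * (\<alpha> + 1 + real i) * (real i + 1) =
       \<Lambda>\<^sub>2 * (N + real \<beta> + 1) * (N + \<alpha>)
       - (real \<beta> + 1) * (real \<beta> + 2) * (real (Suc i) - N) * (real (Suc i) + N + s)"
      unfolding w_def \<Lambda>\<^sub>2_def s_def of_nat_Suc by algebra
    finally show ?thesis by (simp add: Suc mult.assoc)
  qed
qed

text \<open>The additional factor \<open>W\<close> of \<open>W * G\<close> makes Euler's transformation absorb all factors, so that
  the double derivative of the result is again hypergeometric, namely a multiple of \<open>G\<close>: here
  \<open>W * G\<close> is an eigenfunction.\<close>

lemma double_deriv_WG:
  "W * double_deriv (\<beta> + 2) \<alpha> (W ^ (\<beta> + 1) * (W * G)) =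
     smult ((-1) ^ \<beta> * eigval_high \<beta> \<alpha> (Suc \<nu>)) (W * G)"
proof -
  have "W ^ (\<beta> + 2) * G = hyp_poly (\<nu> + (\<beta> + 2)) (\<alpha> + 1 + real \<nu>) (\<alpha> + 1)"
    unfolding G_def by (rule euler_transformation) (use \<alpha> in \<open>simp_all add: s_def N_def\<close>)
  then have e: "W ^ (\<beta> + 1) * (W * G) = hyp_poly (\<nu> + (\<beta> + 2)) (\<alpha> + 1 + real \<nu>) (\<alpha> + 1)"
    by (simp add: mult.assoc mult.left_commute)
  have g: "hyp_poly \<nu> (\<alpha> + 1 + real \<nu> + real (\<beta> + 2)) (\<alpha> + 1) = G"
    by (simp add: G_def s_def N_def algebra_simps)
  have p: "pochhammer (- real (\<nu> + (\<beta> + 2))) (\<beta> + 2) * pochhammer (\<alpha> + 1 + real \<nu>) (\<beta> + 2) =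
     (-1) ^ \<beta> * eigval_high \<beta> \<alpha> (Suc \<nu>)"
    unfolding eigval_high_def by (subst pochhammer_minus_of_nat_add) (simp add: algebra_simps)
  show ?thesis
    unfolding e double_deriv_hyp_poly[OF \<alpha>] g p by (simp only: mult_smult_right)
qed


text \<open>The factor \<open>(\<alpha> + 1)\<^sub>N / N!\<close> belongs to \<open>F\<close> and the bracket on the right to \<open>W * G\<close>.  Both sides
  are the same product of factorials and shifted factorials, because
  \<open>(\<alpha> + 1)\<^sub>N * (N + \<alpha> + 1)\<^sub>\<beta>\<^sub>+\<^sub>1\<close> and \<open>(\<alpha> + 1)\<^sub>\<beta>\<^sub>+\<^sub>1 * (\<alpha> + \<beta> + 2)\<^sub>N\<close> both are \<open>(\<alpha> + 1)\<^sub>N\<^sub>+\<^sub>\<beta>\<^sub>+\<^sub>1\<close>,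
  and \<open>(N)\<^sub>\<beta>\<^sub>+\<^sub>1 * (N - 1)!\<close> and \<open>(\<beta> + 1)! * (\<beta> + 2)\<^sub>N\<^sub>-\<^sub>1\<close> both are \<open>(N + \<beta>)!\<close>.  This is what the
  constants \<open>A\<^sub>n\<close> and \<open>C\<close> are made for.\<close>

lemma connection_constants:
  "pochhammer (\<alpha> + 1) (Suc \<nu>) / fact (Suc \<nu>) * K * (real \<beta> + 2) =
   C_const \<beta> \<alpha> * (2 * jacobi_A (Suc \<nu>) (real \<beta>) \<alpha> * (pochhammer (\<alpha> + 1) \<nu> / fact \<nu>))"
proof -
  have 1: "pochhammer (\<alpha> + 1) (Suc \<nu>) * pochhammer (N + \<alpha> + 1) (Suc \<beta>) =
      pochhammer (\<alpha> + 1) (Suc \<beta>) * pochhammer (\<alpha> + real \<beta> + 2) (Suc \<nu>)"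
    using pochhammer_product'[of "\<alpha> + 1" "Suc \<nu>" "Suc \<beta>"]
      pochhammer_product'[of "\<alpha> + 1" "Suc \<beta>" "Suc \<nu>"]
    by (simp add: N_def add_ac del: pochhammer_Suc)
  have 2: "pochhammer N (Suc \<beta>) * fact \<nu> = fact (Suc \<beta>) * pochhammer (real \<beta> + 2) \<nu>"
    using pochhammer_product'[of "1::real" \<nu> "Suc \<beta>"] pochhammer_product'[of "1::real" "Suc \<beta>" \<nu>]
    unfolding pochhammer_fact N_def by (simp add: add_ac mult_ac)
  have pos: "pochhammer (\<alpha> + 1) \<nu> > 0" using \<alpha> by (intro pochhammer_pos) simp
  have "pochhammer (\<alpha> + 1) (Suc \<nu>) * K * fact \<nu> =
     C_const \<beta> \<alpha> / (real \<beta> + 2) * pochhammer (\<alpha> + real \<beta> + 2) (Suc \<nu>) * pochhammer (real \<beta> + 2) \<nu>"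
  proof -
    have "pochhammer (\<alpha> + 1) (Suc \<nu>) * K * fact \<nu> =
      (pochhammer (\<alpha> + 1) (Suc \<nu>) * pochhammer (N + \<alpha> + 1) (Suc \<beta>)) * (pochhammer N (Suc \<beta>) * fact \<nu>)"
      by (simp only: K_def mult_ac)
    moreover have "fact (Suc \<beta>) = (fact (\<beta> + 2) / (real \<beta> + 2) :: real)"
      by (simp add: divide_simps)
    ultimately show ?thesis unfolding 1 2 C_const_def
      by (simp add: mult_ac del: fact_Suc)
  qed
  then show ?thesis
    using pos by (simp add: jacobi_A_def divide_simps mult_ac del: fact_Suc)
qed


lemma eigval_high_eq: "eigval_high \<beta> \<alpha> (Suc \<nu>) = K * (N + real \<beta> + 1) * (N + \<alpha>)"
proof -
  have "pochhammer N (\<beta> + 2) = pochhammer N (Suc \<beta>) * (N + real \<beta> + 1)"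
    by (simp add: pochhammer_Suc[of N "Suc \<beta>"] add_ac)
  moreover have "pochhammer (N + \<alpha>) (\<beta> + 2) = (N + \<alpha>) * pochhammer (N + \<alpha> + 1) (Suc \<beta>)"
    by (simp add: pochhammer_rec[of "N + \<alpha>" "Suc \<beta>"])
  ultimately show ?thesis
    by (simp add: eigval_high_def K_def N_def)
qed

text \<open>The differential equation in the variable \<open>z\<close>, for positive degree.  As a polynomial in \<open>M\<close> it has
  degree two: the constant term is Gauss's equation for \<open>F\<close>, the quadratic term the eigenvalue
  equation of \<open>W * G\<close>, and in the linear term the multiples of \<open>(\<theta> - N) (\<theta> + N + s) F\<close> cancel.\<close>

lemma jacobi_type_coefficient_equation:
  fixes M p q :: real
  defines "p \<equiv> pochhammer (\<alpha> + 1) (Suc \<nu>) / fact (Suc \<nu>)"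
  defines "q \<equiv> 2 * jacobi_A (Suc \<nu>) (real \<beta>) \<alpha> * (pochhammer (\<alpha> + 1) \<nu> / fact \<nu>)"
  defines "Y \<equiv> smult p F + smult (M * q) (W * G)"
  shows "smult M (smult ((-1) ^ \<beta>) (W * double_deriv (\<beta> + 2) \<alpha> (W ^ (\<beta> + 1) * Y)) - smult (eigval_high \<beta> \<alpha> (Suc \<nu>)) Y)
      = smult (C_const \<beta> \<alpha>) (hyp_op (- N) (N + s) (\<alpha> + 1) Y)"
proof (rule poly_eqI)
  fix j
  \<comment> \<open>The sign gets a name because a power with a symbolic exponent is no ring expression for the method \<open>algebra\<close>; all it has to know is \<open>e * e = 1\<close>.\<close>
  define e :: real where "e = (-1) ^ \<beta>"
  have e: "e * e = 1" by (simp add: e_def power_mult_distrib[symmetric])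
  define f wg h hy C \<Lambda> where "f = coeff F j" "wg = coeff (W * G) j"
    "h = coeff (W * double_deriv (\<beta> + 2) \<alpha> (W ^ (\<beta> + 1) * F)) j"
    "hy = coeff (hyp_op (- N) (N + s) (\<alpha> + 1) (W * G)) j"
    "C = C_const \<beta> \<alpha>" "\<Lambda> = eigval_high \<beta> \<alpha> (Suc \<nu>)"
  note defs = this
  define r where "r = (real j - N) * (real j + N + s)"
  have F0: "hyp_op (- N) (N + s) (\<alpha> + 1) F = 0"
    unfolding F_def N_def using \<alpha> by (intro hyp_op_hyp_poly) simp
  have \<Lambda>2: "\<Lambda>\<^sub>2 \<noteq> 0"
    using \<alpha> by (simp add: \<Lambda>\<^sub>2_def N_def s_def)
  have 1: "\<Lambda>\<^sub>2 * h = e * K * (\<Lambda>\<^sub>2 * (N + real \<beta> + 1) * (N + \<alpha>) - (real \<beta> + 1) * (real \<beta> + 2) * r) * f"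
    using coeff_W_double_deriv_F[of j] by (simp add: defs e_def r_def mult.assoc)
  have 2: "\<Lambda>\<^sub>2 * hy = - (real \<beta> + 1) * r * f"
    using coeff_hyp_op_WG[of j] by (simp add: defs r_def mult.assoc)
  have 3: "\<Lambda> = K * (N + real \<beta> + 1) * (N + \<alpha>)"
    unfolding defs by (rule eigval_high_eq)
  have 4: "p * K * (real \<beta> + 2) = C * q"
    unfolding p_def q_def defs by (rule connection_constants)
  have "\<Lambda>\<^sub>2 * (M * (e * (p * h + M * q * (e * \<Lambda> * wg)) - \<Lambda> * (p * f + M * q * wg))) = \<Lambda>\<^sub>2 * (C * (M * q * hy))"
    using 1 2 3 4 e by algebra
  then have "M * (e * (p * h + M * q * (e * \<Lambda> * wg)) - \<Lambda> * (p * f + M * q * wg)) = C * (M * q * hy)"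
    using \<Lambda>2 by simp
  moreover have "W * double_deriv (\<beta> + 2) \<alpha> (W ^ (\<beta> + 1) * Y) =
     smult p (W * double_deriv (\<beta> + 2) \<alpha> (W ^ (\<beta> + 1) * F)) + smult (M * q * (e * \<Lambda>)) (W * G)"
  proof -
    have "W ^ (\<beta> + 1) * Y = smult p (W ^ (\<beta> + 1) * F) + smult (M * q) (W ^ (\<beta> + 1) * (W * G))"
      by (simp only: Y_def distrib_left mult_smult_right)
    then show ?thesis
      by (simp only: double_deriv_add double_deriv_smult distrib_left mult_smult_right double_deriv_WG smult_smult e_def defs)
  qed
  moreover have "hyp_op (- N) (N + s) (\<alpha> + 1) Y = smult (M * q) (hyp_op (- N) (N + s) (\<alpha> + 1) (W * G))"
    by (simp add: Y_def hyp_op_add hyp_op_smult F0)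
  ultimately show "coeff (smult M (smult ((-1) ^ \<beta>) (W * double_deriv (\<beta> + 2) \<alpha> (W ^ (\<beta> + 1) * Y)) - smult (eigval_high \<beta> \<alpha> (Suc \<nu>)) Y)) j
      = coeff (smult (C_const \<beta> \<alpha>) (hyp_op (- N) (N + s) (\<alpha> + 1) Y)) j"
    unfolding e_def[symmetric] defs(6)[symmetric] defs(5)[symmetric]
    by (simp only: coeff_smult coeff_diff coeff_add defs(1-4)[symmetric]) (simp add: Y_def defs(1-4) mult_ac)
qed

end

section \<open>Iterated derivatives and smooth functions\<close>

lemma Dx_0 [simp]: "Dx 0 f = f"
  by (simp add: Dx_def)

lemma Dx_Suc: "Dx (Suc i) f = (\<lambda>t. vector_derivative (Dx i f) (at t))"
  by (simp add: Dx_def)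

lemma Dx_1: "Dx (Suc 0) f = (\<lambda>t. vector_derivative f (at t))"
  by (simp add: Dx_Suc)

lemma Dx_Suc_left: "Dx (Suc i) f = Dx (Suc 0) (Dx i f)"
  by (simp add: Dx_Suc)

lemma vector_derivative_eq_on_open:
  assumes "open S" "x \<in> S" "\<And>t. t \<in> S \<Longrightarrow> f t = g t" "(g has_vector_derivative D) (at x)"
  shows "(f has_vector_derivative D) (at x)"
  using has_vector_derivative_transform_within_open[OF assms(4,1,2)] assms(3) by simp

lemma Dx_cong:
  assumes "open S" "\<And>t. t \<in> S \<Longrightarrow> f t = g t" "x \<in> S"
  shows "Dx i f x = Dx i g x"
  using assms(3)
proof (induction i arbitrary: x)
  case (Suc i)
  have "eventually (\<lambda>t. Dx i f t = Dx i g t) (nhds x)"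
    using Suc \<open>open S\<close> by (auto simp: eventually_nhds)
  then show ?case
    unfolding Dx_Suc by (intro vector_derivative_cong_eq) auto
qed (simp add: assms)

text \<open>Smoothness is a coinductive property: a class of functions each of which has a derivative within
  the class consists of smooth functions.  This avoids formulas for higher derivatives, and the
  class need only be closed under differentiation on \<open>S\<close>.\<close>

lemma smooth_coinduct:
  assumes "open S" "X f"
    and step: "\<And>g. X g \<Longrightarrow> \<exists>g'. X g' \<and> (\<forall>x\<in>S. (g has_vector_derivative g' x) (at x))"
  shows "smooth_fun_on S f"
proof -
  have deriv: "\<exists>g'. X g' \<and> (\<forall>x\<in>S. (Dx i f has_vector_derivative g' x) (at x))"
    if "X g" "\<forall>x\<in>S. Dx i f x = g x" for i g
  proof -
    obtain g' where g': "X g'" "\<forall>x\<in>S. (g has_vector_derivative g' x) (at x)"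
      using step[OF \<open>X g\<close>] by blast
    have "(Dx i f has_vector_derivative g' x) (at x)" if "x \<in> S" for x
      by (rule vector_derivative_eq_on_open[OF \<open>open S\<close> that, of _ g])
         (use g' \<open>\<forall>x\<in>S. Dx i f x = g x\<close> that in simp_all)
    then show ?thesis using g'(1) by blast
  qed
  \<comment> \<open>Outside \<open>S\<close> nothing is known about \<open>f\<close>, so its higher derivatives are identified with members of \<open>X\<close> on \<open>S\<close> only.\<close>
  have agree: "\<exists>g. X g \<and> (\<forall>x\<in>S. Dx i f x = g x)" for i
  proof (induction i)
    case 0
    show ?case by (rule exI[of _ f]) (simp add: \<open>X f\<close>)
  next
    case (Suc i)
    then obtain g' where "X g'" "\<forall>x\<in>S. (Dx i f has_vector_derivative g' x) (at x)"
      using deriv by blast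
    then show ?case
      by (intro exI[of _ g']) (simp add: Dx_Suc vector_derivative_at)
  qed
  have "\<exists>g'. X g' \<and> (\<forall>x\<in>S. (Dx i f has_vector_derivative g' x) (at x))" for i
    using agree[of i] deriv by blast
  then show ?thesis
    unfolding smooth_fun_on_def by (meson differentiableI_vector)
qed

lemma smooth_has_derivative:
  "smooth_fun_on S f \<Longrightarrow> x \<in> S \<Longrightarrow> (Dx i f has_vector_derivative Dx (Suc i) f x) (at x)"
  unfolding Dx_Suc smooth_fun_on_def by (metis vector_derivative_works)

lemma smooth_Dx: "smooth_fun_on S f \<Longrightarrow> smooth_fun_on S (Dx i f)"
proof -
  have "Dx j (Dx i f) = Dx (j + i) f" for j by (simp add: Dx_def funpow_add)
  then show "smooth_fun_on S f \<Longrightarrow> smooth_fun_on S (Dx i f)" by (simp add: smooth_fun_on_def)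
qed

text \<open>The derivative of a product is a sum of products, so products of smooth functions alone are not
  closed under differentiation, but the algebra that smooth functions generate is.\<close>

inductive smooth_algebra :: "real set \<Rightarrow> (real \<Rightarrow> real) \<Rightarrow> bool" for S where
  base: "smooth_fun_on S f \<Longrightarrow> smooth_algebra S f"
| add: "smooth_algebra S f \<Longrightarrow> smooth_algebra S g \<Longrightarrow> smooth_algebra S (\<lambda>x. f x + g x)"
| mult: "smooth_algebra S f \<Longrightarrow> smooth_algebra S g \<Longrightarrow> smooth_algebra S (\<lambda>x. f x * g x)"

lemma smooth_algebra_smooth:
  assumes "open S" "smooth_algebra S f"
  shows "smooth_fun_on S f"
  using assms
proof (rule smooth_coinduct[where X = "smooth_algebra S"])
  fix g assume "smooth_algebra S g"
  then show "\<exists>g'. smooth_algebra S g' \<and> (\<forall>x\<in>S. (g has_vector_derivative g' x) (at x))"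
  proof induction
    case (base f)
    then show ?case
      using smooth_has_derivative[OF base, of _ 0] smooth_Dx[OF base, of 1]
      by (auto intro: smooth_algebra.base)
  next
    case (add f g)
    then obtain f' g' where "smooth_algebra S f'" "\<forall>x\<in>S. (f has_vector_derivative f' x) (at x)"
      "smooth_algebra S g'" "\<forall>x\<in>S. (g has_vector_derivative g' x) (at x)" by blast
    then show ?case
      by (intro exI[of _ "\<lambda>x. f' x + g' x"])
         (simp add: smooth_algebra.add has_vector_derivative_add)
  next
    case (mult f g)
    then obtain f' g' where "smooth_algebra S f'" "\<forall>x\<in>S. (f has_vector_derivative f' x) (at x)"
      "smooth_algebra S g'" "\<forall>x\<in>S. (g has_vector_derivative g' x) (at x)" by blast
    then show ?case using mult.hyps
      by (intro exI[of _ "\<lambda>x. f x * g' x + f' x * g x"])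
         (simp add: smooth_algebra.add smooth_algebra.mult has_vector_derivative_mult)
  qed
qed

lemma smooth_add:
  "open S \<Longrightarrow> smooth_fun_on S f \<Longrightarrow> smooth_fun_on S g \<Longrightarrow> smooth_fun_on S (\<lambda>x. f x + g x)"
  and smooth_mult:
  "open S \<Longrightarrow> smooth_fun_on S f \<Longrightarrow> smooth_fun_on S g \<Longrightarrow> smooth_fun_on S (\<lambda>x. f x * g x)"
  by (simp_all add: smooth_algebra_smooth smooth_algebra.intros)

lemma smooth_poly: "open S \<Longrightarrow> smooth_fun_on S (\<lambda>x. poly p ((1 - x) / 2))"
proof (rule smooth_coinduct[where X = "\<lambda>f. \<exists>p. f = (\<lambda>x. poly p ((1 - x) / 2))"])
  fix g :: "real \<Rightarrow> real"
  assume "\<exists>p. g = (\<lambda>x. poly p ((1 - x) / 2))"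
  then obtain p where g: "g = (\<lambda>x. poly p ((1 - x) / 2))" by blast
  have "(g has_vector_derivative poly (smult (-1/2) (pderiv p)) ((1 - x) / 2)) (at x)" for x
    unfolding g has_real_derivative_iff_has_vector_derivative[symmetric]
    by (auto intro!: derivative_eq_intros)
  then show "\<exists>g'. (\<exists>p. g' = (\<lambda>x. poly p ((1 - x) / 2))) \<and> (\<forall>x\<in>S. (g has_vector_derivative g' x) (at x))"
    by (intro exI[of _ "\<lambda>x. poly (smult (-1/2) (pderiv p)) ((1 - x) / 2)"]) blast
qed auto

lemma smooth_powr:
  assumes "open S" "S \<subseteq> {..<1}"
  shows "smooth_fun_on S (\<lambda>x. (1 - x) powr a)"
proof (rule smooth_coinduct[where X = "\<lambda>f. \<exists>c a. f = (\<lambda>x. c * (1 - x) powr a)"])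
  fix g :: "real \<Rightarrow> real"
  assume "\<exists>c a. g = (\<lambda>x. c * (1 - x) powr a)"
  then obtain c a where g: "g = (\<lambda>x. c * (1 - x) powr a)" by blast
  have "(g has_vector_derivative - c * a * (1 - x) powr (a - 1)) (at x)" if "x \<in> S" for x
    unfolding g has_real_derivative_iff_has_vector_derivative[symmetric]
    using that assms by (auto intro!: derivative_eq_intros)
  then show "\<exists>g'. (\<exists>c a. g' = (\<lambda>x. c * (1 - x) powr a)) \<and> (\<forall>x\<in>S. (g has_vector_derivative g' x) (at x))"
    by (intro exI[of _ "\<lambda>x. - c * a * (1 - x) powr (a - 1)"]) blast
next
  show "\<exists>c b. (\<lambda>x. (1 - x) powr a) = (\<lambda>x. c * (1 - x) powr b)"
    by (rule exI[of _ 1]) auto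
qed (rule assms(1))

lemma one_plus_power_eq_W: "((x::real) + 1) ^ k = poly (smult (2 ^ k) (W ^ k)) ((1 - x) / 2)"
proof -
  have "x + 1 = 2 * (1 - (1 - x) / 2)" by (simp add: field_simps)
  then show ?thesis by (simp only: poly_smult poly_power poly_W power_mult_distrib)
qed

lemma smooth_one_plus_power: "open S \<Longrightarrow> smooth_fun_on S (\<lambda>x. (x + 1) ^ k)"
  unfolding one_plus_power_eq_W by (rule smooth_poly)

section \<open>Differential operators with smooth coefficients\<close>

text \<open>Linear operators of the form \<open>c D\<^sup>N\<close> plus lower order terms.  In contrast to
  \<^const>\<open>linear_diff_op_of_order\<close> the coefficients have to be smooth, so that such an operator can be
  followed by a differentiation, and the leading coefficient is named, so that it can be traced.\<close>

definition smooth_diff_op :: "real set \<Rightarrow> nat \<Rightarrow> (real \<Rightarrow> real) \<Rightarrow> ((real \<Rightarrow> real) \<Rightarrow> real \<Rightarrow> real) \<Rightarrow> bool" where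
  "smooth_diff_op S N c T \<longleftrightarrow> (\<exists>a. (\<forall>i. smooth_fun_on S (a i)) \<and> a N = c \<and>
     (\<forall>y. smooth_fun_on S y \<longrightarrow> (\<forall>x\<in>S. T y x = (\<Sum>i\<le>N. a i x * Dx i y x))))"

lemma smooth_diff_op_mult:
  assumes "open S" "smooth_fun_on S f" "smooth_diff_op S N c T"
  shows "smooth_diff_op S N (\<lambda>x. f x * c x) (\<lambda>y x. f x * T y x)"
proof -
  obtain a where a: "\<forall>i. smooth_fun_on S (a i)" "a N = c"
    "\<forall>y. smooth_fun_on S y \<longrightarrow> (\<forall>x\<in>S. T y x = (\<Sum>i\<le>N. a i x * Dx i y x))"
    using assms unfolding smooth_diff_op_def by auto
  then show ?thesis
    unfolding smooth_diff_op_def using assms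
    by (intro exI[of _ "\<lambda>i x. f x * a i x"]) (simp add: smooth_mult sum_distrib_left mult_ac)
qed

lemma smooth_diff_op_id: "open S \<Longrightarrow> smooth_diff_op S 0 (\<lambda>_. 1) (\<lambda>y. y)"
  unfolding smooth_diff_op_def using smooth_one_plus_power[of S 0] by (intro exI[of _ "\<lambda>_ _. 1"]) auto

text \<open>By the product rule the new coefficients are \<open>a\<^sub>i' + a\<^sub>i\<^sub>-\<^sub>1\<close>; at the top only \<open>a\<^sub>N\<close> is left, so the
  leading coefficient survives.\<close>

lemma smooth_diff_op_deriv:
  assumes "open S" "smooth_diff_op S N c T"
  shows "smooth_diff_op S (Suc N) c (\<lambda>y. Dx (Suc 0) (T y))"
proof -
  obtain a where a: "\<And>i. smooth_fun_on S (a i)" "a N = c"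
    "\<And>y x. smooth_fun_on S y \<Longrightarrow> x\<in>S \<Longrightarrow> T y x = (\<Sum>i\<le>N. a i x * Dx i y x)"
    using assms unfolding smooth_diff_op_def by auto
  define b where "b i = (case i of 0 \<Rightarrow> Dx 1 (a 0)
     | Suc j \<Rightarrow> if j < N then (\<lambda>x. Dx 1 (a (Suc j)) x + a j x) else a j)" for i
  have "smooth_fun_on S (b i)" for i
    by (simp add: b_def smooth_add smooth_Dx a \<open>open S\<close> split: nat.split)
  moreover have "b (Suc N) = c" by (simp add: b_def a)
  moreover have "Dx (Suc 0) (T y) x = (\<Sum>i\<le>Suc N. b i x * Dx i y x)"
    if y: "smooth_fun_on S y" and x: "x \<in> S" for x y
  proof -
    have d: "((\<lambda>x. \<Sum>i\<le>N. a i x * Dx i y x) has_vector_derivative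
       (\<Sum>i\<le>N. a i x * Dx (Suc i) y x + Dx 1 (a i) x * Dx i y x)) (at x)"
      using smooth_has_derivative[OF a(1) x, where i = 0] smooth_has_derivative[OF y x]
      by (intro has_vector_derivative_sum has_vector_derivative_mult) simp_all
    have "Dx (Suc 0) (T y) x = (\<Sum>i\<le>N. a i x * Dx (Suc i) y x + Dx 1 (a i) x * Dx i y x)"
      unfolding Dx_1[of "T y"]
      by (intro vector_derivative_at vector_derivative_eq_on_open[OF \<open>open S\<close> x _ d] a(3) y)
    also have "\<dots> = (\<Sum>i\<le>N. a i x * Dx (Suc i) y x) + (\<Sum>i\<le>N. Dx 1 (a i) x * Dx i y x)"
      by (rule sum.distrib)
    also have "(\<Sum>i\<le>N. Dx 1 (a i) x * Dx i y x) =
       Dx 1 (a 0) x * y x + (\<Sum>i<N. Dx 1 (a (Suc i)) x * Dx (Suc i) y x)"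
      by (subst sum.atMost_shift) simp
    also have "(\<Sum>i\<le>N. a i x * Dx (Suc i) y x) =
        (\<Sum>i<N. a i x * Dx (Suc i) y x) + a N x * Dx (Suc N) y x"
      by (simp add: lessThan_Suc_atMost[symmetric])
    finally have "Dx (Suc 0) (T y) x = Dx 1 (a 0) x * y x + 
       (\<Sum>i<N. (Dx 1 (a (Suc i)) x + a i x) * Dx (Suc i) y x) + a N x * Dx (Suc N) y x"
      by (simp add: distrib_right sum.distrib)
    also have "\<dots> = b 0 x * y x + (\<Sum>i<N. b (Suc i) x * Dx (Suc i) y x) + b (Suc N) x * Dx (Suc N) y x"
      by (simp add: b_def)
    also have "\<dots> = (\<Sum>i\<le>Suc N. b i x * Dx i y x)"
      by (subst sum.atMost_shift) (simp add: lessThan_Suc)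
    finally show ?thesis .
  qed
  ultimately show ?thesis unfolding smooth_diff_op_def by blast
qed

lemma smooth_diff_op_Dx:
  assumes "open S" "smooth_diff_op S N c T"
  shows "smooth_diff_op S (N + m) c (\<lambda>y. Dx m (T y))"
proof (induction m)
  case (Suc m)
  then show ?case
    unfolding Dx_Suc_left[of m] using smooth_diff_op_deriv[OF \<open>open S\<close>, of "N + m"] by simp
qed (use assms in simp)

section \<open>Complex powers and the operator of high order\<close>

lemma Dx_cmult_of_real:
  assumes "open S" "smooth_fun_on S h" "x \<in> S"
  shows "Dx i (\<lambda>t. c * complex_of_real (h t)) x = c * complex_of_real (Dx i h x)"
  using assms(3)
proof (induction i arbitrary: x)
  case (Suc i)
  have "(Dx i h has_vector_derivative Dx (Suc i) h x) (at x)"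
    by (rule smooth_has_derivative[OF assms(2) Suc.prems])
  then have d: "((\<lambda>t. c * complex_of_real (Dx i h t)) has_vector_derivative c * complex_of_real (Dx (Suc i) h x)) (at x)"
    by (intro has_vector_derivative_mult_right has_vector_derivative_of_real)
       (simp add: has_real_derivative_iff_has_vector_derivative)
  show ?case
    unfolding Dx_Suc[of i "\<lambda>t. c * _ t"]
    by (intro vector_derivative_at vector_derivative_eq_on_open[OF \<open>open S\<close> Suc.prems _ d] Suc.IH)
qed simp

text \<open>On \<open>t < 1\<close> the logarithm of \<open>t - 1\<close> on the branch \<open>k\<close> is \<open>ln (1 - t)\<close> plus the constant
  \<open>(2 k + 1) \<pi> \<i>\<close>, so the power is real up to a phase that does not depend on \<open>t\<close>.\<close>

lemma branch_powr_left_of_1: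
  assumes "t < 1"
  shows "branch_powr k (t - 1) a =
    exp (\<i> * of_real (a * (pi * (2 * of_int k + 1)))) * complex_of_real ((1 - t) powr a)"
proof -
  have "Ln (complex_of_real (t - 1)) = of_real (ln (1 - t)) + \<i> * of_real pi"
    using Ln_of_real'[of "t - 1"] assms by simp
  then show ?thesis
    using assms unfolding branch_powr_def powr_def
    by (simp add: exp_of_real[symmetric] exp_add[symmetric] algebra_simps)
qed

text \<open>The operator of order \<open>2 * m\<close> with the powers of \<open>x - 1\<close> replaced by real powers of \<open>1 - x\<close>.\<close>

definition high_op :: "nat \<Rightarrow> real \<Rightarrow> (real \<Rightarrow> real) \<Rightarrow> real \<Rightarrow> real" where
  "high_op m \<alpha> y x = (x + 1) * (1 - x) powr (- \<alpha>) *
     Dx m (\<lambda>t. (1 - t) powr (\<alpha> + real m) * Dx m (\<lambda>s. (s + 1) ^ (m - 1) * y s) t) x"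

text \<open>The phases of exponents \<open>\<alpha>\<close> and \<open>\<alpha> + \<beta> + 2\<close> differ by the factor
  \<open>exp (\<i> \<pi> (2 k + 1) (\<beta> + 2)) = (-1) ^ \<beta>\<close>, which is all that remains of the choice of the branch.\<close>

lemma L_high_op_eq_high_op:
  assumes y: "smooth_fun_on {-1<..<1} y" and x: "x \<in> {-1<..<1}"
  shows "L_high_op k \<beta> \<alpha> y x = complex_of_real ((-1) ^ \<beta> * high_op (\<beta> + 2) \<alpha> y x)"
proof -
  let ?S = "{-1<..<1::real}"
  let ?E = "\<lambda>a. exp (\<i> * of_real (a * (pi * (2 * of_int k + 1))))"
  define g where "g = Dx (\<beta> + 2) (\<lambda>s. (s + 1) ^ (\<beta> + 1) * y s)"
  define h where "h t = (1 - t) powr (\<alpha> + real (\<beta> + 2)) * g t" for t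
  have h: "smooth_fun_on ?S h"
    unfolding h_def g_def
    by (intro smooth_mult smooth_Dx smooth_powr smooth_one_plus_power y) auto
  have "Dx (\<beta> + 2) (\<lambda>t. branch_powr k (t - 1) (\<alpha> + real \<beta> + 2) * complex_of_real (g t)) x =
     Dx (\<beta> + 2) (\<lambda>t. ?E (\<alpha> + real (\<beta> + 2)) * complex_of_real (h t)) x"
    by (rule Dx_cong[of ?S]) (use x in \<open>auto simp: branch_powr_left_of_1 h_def add_ac\<close>)
  also have "\<dots> = ?E (\<alpha> + real (\<beta> + 2)) * complex_of_real (Dx (\<beta> + 2) h x)"
    by (rule Dx_cmult_of_real[OF _ h x]) simp
  finally have 1: "L_high_op k \<beta> \<alpha> y x = complex_of_real (x + 1) / (?E \<alpha> * complex_of_real ((1 - x) powr \<alpha>)) *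
     (?E (\<alpha> + real (\<beta> + 2)) * complex_of_real (Dx (\<beta> + 2) h x))"
    using x by (simp add: L_high_op_def g_def branch_powr_left_of_1)
  have "?E (\<alpha> + real (\<beta> + 2)) = ?E \<alpha> * exp (\<i> * of_real ((pi * (2 * of_int k + 1)))) ^ (\<beta> + 2)"
    unfolding exp_of_nat_mult[symmetric] exp_add[symmetric] by (simp add: algebra_simps)
  also have "exp (\<i> * of_real ((pi * (2 * of_int k + 1)))) = -1"
    using exp_integer_2pi[of "of_int k"] by (simp add: distrib_left exp_add mult_ac)
  finally have 2: "?E (\<alpha> + real (\<beta> + 2)) = ?E \<alpha> * (-1) ^ \<beta>" by simp
  have 3: "high_op (\<beta> + 2) \<alpha> y x = (x + 1) * inverse ((1 - x) powr \<alpha>) * Dx (\<beta> + 2) h x"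
    unfolding high_op_def h_def[abs_def] g_def powr_minus by simp
  have cancel: "X / (E * P) * (E * e * D) = e * (X * inverse P * D)" if "E \<noteq> 0" for X E P e D :: complex
    using that by (simp add: divide_inverse)
  have "complex_of_real ((-1) ^ \<beta> * high_op (\<beta> + 2) \<alpha> y x) = (-1) ^ \<beta> *
      (complex_of_real (x + 1) * inverse (complex_of_real ((1 - x) powr \<alpha>)) * complex_of_real (Dx (\<beta> + 2) h x))"
    unfolding 3 by (simp only: of_real_mult of_real_inverse of_real_power of_real_minus of_real_1)
  then show ?thesis unfolding 1 2 by (subst cancel) simp_all
qed

text \<open>The leading coefficient is the product of all functions by which the operator multiplies.\<close>

lemma smooth_diff_op_high_op:
  assumes "open S" "S \<subseteq> {..<1}"
  shows "smooth_diff_op S (m + m) (\<lambda>x. ((x + 1) * (1 - x) powr (- \<alpha>)) * ((1 - x) powr (\<alpha> + real m) * (x + 1) ^ (m - 1)))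
    (high_op m \<alpha>)"
proof -
  note * = smooth_diff_op_mult[OF \<open>open S\<close>] smooth_diff_op_Dx[OF \<open>open S\<close>]
  have "smooth_fun_on S (\<lambda>x. (x + 1) * (1 - x) powr (- \<alpha>))"
    using smooth_mult[OF _ smooth_one_plus_power[of S 1] smooth_powr] assms by simp
  then have "smooth_diff_op S (0 + m + m) (\<lambda>x. ((x + 1) * (1 - x) powr (- \<alpha>)) * ((1 - x) powr (\<alpha> + real m) * ((x + 1) ^ (m - 1) * 1)))
    (\<lambda>y x. (x + 1) * (1 - x) powr (- \<alpha>) *
     Dx m (\<lambda>t. (1 - t) powr (\<alpha> + real m) * Dx m (\<lambda>s. (s + 1) ^ (m - 1) * y s) t) x)"
    by (intro * smooth_powr smooth_one_plus_power smooth_diff_op_id assms)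
  then show ?thesis by (simp add: high_op_def[abs_def])
qed

section \<open>The operators on polynomials\<close>

lemma Dx_poly:
  "Dx i (\<lambda>s. poly p ((1 - s) / 2)) = (\<lambda>t. poly (smult ((-1/2) ^ i) ((pderiv ^^ i) p)) ((1 - t) / 2))"
proof (induction i)
  case (Suc i)
  have "((\<lambda>t. poly q ((1 - t) / 2)) has_vector_derivative poly (smult (-1/2) (pderiv q)) ((1 - x) / 2)) (at x)"
    for x and q :: "real poly"
    unfolding has_real_derivative_iff_has_vector_derivative[symmetric]
    by (auto intro!: derivative_eq_intros)
  from vector_derivative_at[OF this] show ?case
    unfolding Dx_Suc Suc by (simp add: pderiv_smult del: poly_smult)
qed simp

lemma Dx_powr_mult_poly:
  assumes "x < 1"
  shows "Dx i (\<lambda>t. (1 - t) powr a * poly p ((1 - t) / 2)) x =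
    (-1) ^ i * ((1 - x) powr (a - real i) * poly (weighted_deriv i a p) ((1 - x) / 2))"
  using assms
proof (induction i arbitrary: x)
  case (Suc i)
  let ?q = "weighted_deriv i a p" and ?b = "a - real i"
  have "((\<lambda>t. (-1) ^ i * ((1 - t) powr ?b * poly ?q ((1 - t) / 2))) has_real_derivative
     (-1) ^ i * (- ?b * (1 - x) powr (?b - 1) * poly ?q ((1 - x) / 2)
       + (1 - x) powr ?b * (poly (pderiv ?q) ((1 - x) / 2) * (-1/2)))) (at x)"
    using Suc.prems by (auto intro!: derivative_eq_intros simp: algebra_simps)
  moreover have "(-1) ^ i * (- ?b * (1 - x) powr (?b - 1) * poly ?q ((1 - x) / 2)
       + (1 - x) powr ?b * (poly (pderiv ?q) ((1 - x) / 2) * (-1/2))) =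
     (-1) ^ Suc i * ((1 - x) powr (a - real (Suc i)) * poly (weighted_deriv (Suc i) a p) ((1 - x) / 2))"
  proof -
    have U: "(1 - x) powr ?b = (1 - x) powr (?b - 1) * (1 - x)"
      using Suc.prems by (simp add: powr_diff)
    have "a - real (Suc i) = ?b - 1" by simp
    then show ?thesis
      unfolding U weighted_deriv.simps by (simp only: poly_add poly_smult poly_pCons) (simp add: field_simps)
  qed
  ultimately have "((\<lambda>t. (-1) ^ i * ((1 - t) powr ?b * poly ?q ((1 - t) / 2))) has_vector_derivative
     (-1) ^ Suc i * ((1 - x) powr (a - real (Suc i)) * poly (weighted_deriv (Suc i) a p) ((1 - x) / 2))) (at x)"
    unfolding has_real_derivative_iff_has_vector_derivative[symmetric]
    by (simp only:)
  from vector_derivative_eq_on_open[OF _ _ Suc.IH this, of "{..<1}"] show ?case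
    unfolding Dx_Suc using Suc.prems by (intro vector_derivative_at) auto
qed simp

lemma weighted_deriv_smult: "weighted_deriv i a (smult c p) = smult c (weighted_deriv i a p)"
  by (intro poly_eqI) (simp add: coeff_weighted_deriv)

text \<open>With \<open>z = (1 - x) / 2\<close> each of the \<open>2 * \<beta> + 4\<close> differentiations contributes \<open>-1/2\<close>, while
  \<open>1 - x = 2 * z\<close> and \<open>x + 1 = 2 * (1 - z)\<close> contribute \<open>2\<close> to the power \<open>\<beta> + 2\<close> each.  These constants
  cancel.\<close>

lemma high_op_poly:
  assumes "x < 1"
  shows "high_op (\<beta> + 2) \<alpha> (\<lambda>t. poly p ((1 - t) / 2)) x =
     poly (W * double_deriv (\<beta> + 2) \<alpha> (W ^ (\<beta> + 1) * p)) ((1 - x) / 2)"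
proof -
  let ?m = "\<beta> + 2"
  let ?q = "W ^ (\<beta> + 1) * p"
  have "(\<lambda>s. (s + 1) ^ (?m - 1) * poly p ((1 - s) / 2)) = (\<lambda>s. poly (smult (2 ^ (\<beta> + 1)) ?q) ((1 - s) / 2))"
    by (simp add: one_plus_power_eq_W mult.assoc del: power_Suc)
  then have "high_op ?m \<alpha> (\<lambda>t. poly p ((1 - t) / 2)) x = (x + 1) * (1 - x) powr (- \<alpha>) *
     Dx ?m (\<lambda>t. (1 - t) powr (\<alpha> + real ?m) * poly (smult (2 ^ (\<beta> + 1) * (-1/2) ^ ?m) ((pderiv ^^ ?m) ?q)) ((1 - t) / 2)) x"
    unfolding high_op_def by (simp only: Dx_poly higher_pderiv_smult smult_smult mult_ac)
  \<comment> \<open>The powers of \<open>1 - x\<close> stay as they are, so the outer differentiations contribute signs only.\<close>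
  also have "\<dots> = ((x + 1) / 2) * ((1 - x) powr (- \<alpha>) * (1 - x) powr \<alpha>) * ((-1) ^ ?m * (2 * (2 ^ (\<beta> + 1) * (-1/2) ^ ?m))) *
      poly (double_deriv ?m \<alpha> ?q) ((1 - x) / 2)"
    unfolding Dx_powr_mult_poly[OF assms] weighted_deriv_smult double_deriv_def by simp
  also have "(1 - x) powr (- \<alpha>) * (1 - x) powr \<alpha> = 1"
    using assms by (simp add: powr_add[symmetric])
  also have "(-1) ^ ?m * (2 * (2 ^ (\<beta> + 1) * (-1/2) ^ ?m)) = (1::real)"
    by (simp add: power_mult_distrib[symmetric])
  finally show ?thesis by (simp add: field_simps)
qed

text \<open>The sign comes from \<open>x\<^sup>2 - 1 = - 4 * z * (1 - z)\<close>.\<close>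

lemma L2_op_poly:
  "L2_op \<alpha> b (\<lambda>t. poly p ((1 - t) / 2)) x - eigval_2 \<alpha> b n * poly p ((1 - x) / 2) =
     - poly (hyp_op (- real n) (real n + \<alpha> + b + 1) (\<alpha> + 1) p) ((1 - x) / 2)"
proof -
  define z where "z = (1 - x) / 2"
  have x: "x = 1 - 2 * z" by (simp add: z_def field_simps)
  have "(1 - x) / 2 = z" by (simp add: z_def)
  moreover have "(pderiv ^^ 2) p = pderiv (pderiv p)" by (simp add: numeral_2_eq_2)
  ultimately show ?thesis
    unfolding L2_op_def eigval_2_def Dx_poly hyp_op_def
    by (simp add: x power2_eq_square algebra_simps)
qed

lemma jacobi_P_poly:
  "jacobi_P n \<alpha> b x =
     poly (smult (pochhammer (\<alpha> + 1) n / fact n) (hyp_poly n (real n + \<alpha> + b + 1) (\<alpha> + 1))) ((1 - x) / 2)"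
proof -
  have "eval_fps (fps_hypergeo [- real n, real n + \<alpha> + b + 1] [\<alpha> + 1] 1) z =
    poly (hyp_poly n (real n + \<alpha> + b + 1) (\<alpha> + 1)) z" for z
    unfolding eval_fps_def
    by (subst suminf_finite[of "{..n}"])
       (auto simp: hyp_poly_def poly_sum poly_monom pochhammer_of_nat_eq_0_lemma)
  then show ?thesis by (simp add: jacobi_P_def)
qed

lemma jacobi_type_poly_0: "jacobi_type 0 \<alpha> b M x = poly 1 ((1 - x) / 2)"
  by (simp add: jacobi_type_def jacobi_Q_def jacobi_P_poly) (simp add: hyp_poly_def)

lemma jacobi_type_poly_Suc:
  fixes \<nu> :: nat
  defines "N \<equiv> real (Suc \<nu>)"
  shows "jacobi_type (Suc \<nu>) \<alpha> b M x = poly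
    (smult (pochhammer (\<alpha> + 1) (Suc \<nu>) / fact (Suc \<nu>)) (hyp_poly (Suc \<nu>) (N + (\<alpha> + b + 1)) (\<alpha> + 1)) +
     smult (M * (2 * jacobi_A (Suc \<nu>) b \<alpha> * (pochhammer (\<alpha> + 1) \<nu> / fact \<nu>)))
       (W * hyp_poly \<nu> (N + (\<alpha> + b + 1) + 1) (\<alpha> + 1))) ((1 - x) / 2)"
proof -
  have "real \<nu> + \<alpha> + (b + 2) + 1 = N + (\<alpha> + b + 1) + 1" "N + \<alpha> + b + 1 = N + (\<alpha> + b + 1)"
    by (simp_all add: N_def)
  then have "jacobi_type (Suc \<nu>) \<alpha> b M x = poly
    (smult (pochhammer (\<alpha> + 1) (Suc \<nu>) / fact (Suc \<nu>)) (hyp_poly (Suc \<nu>) (N + (\<alpha> + b + 1)) (\<alpha> + 1))) ((1 - x) / 2) +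
     M * (jacobi_A (Suc \<nu>) b \<alpha> * (x + 1) *
       poly (smult (pochhammer (\<alpha> + 1) \<nu> / fact \<nu>) (hyp_poly \<nu> (N + (\<alpha> + b + 1) + 1) (\<alpha> + 1))) ((1 - x) / 2))"
    by (simp add: jacobi_type_def jacobi_Q_def jacobi_P_poly N_def del: poly_smult pochhammer_Suc fact_Suc)
  also have "x + 1 = 2 * poly W ((1 - x) / 2)" by (simp add: field_simps)
  finally show ?thesis by (simp only: poly_add poly_smult poly_mult mult_ac)
qed

text \<open>A polynomial identity in \<open>z\<close> is the differential equation in \<open>x\<close>, by the translation of the two
  operators.\<close>

lemma operator_equation:
  fixes Y :: "real poly"
  assumes x: "x \<in> {-1<..<1}"
    and eq: "smult M (smult ((-1) ^ \<beta>) (W * double_deriv (\<beta> + 2) \<alpha> (W ^ (\<beta> + 1) * Y)) - smult (eigval_high \<beta> \<alpha> n) Y)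
      = smult (C_const \<beta> \<alpha>) (hyp_op (- real n) (real n + \<alpha> + real \<beta> + 1) (\<alpha> + 1) Y)"
  defines "y \<equiv> \<lambda>t. poly Y ((1 - t) / 2)"
  shows "complex_of_real M * (L_high_op k \<beta> \<alpha> y x - complex_of_real (eigval_high \<beta> \<alpha> n * y x))
      + complex_of_real (C_const \<beta> \<alpha> * (L2_op \<alpha> (real \<beta>) y x - eigval_2 \<alpha> (real \<beta>) n * y x)) = 0"
proof -
  have "L_high_op k \<beta> \<alpha> y x = complex_of_real ((-1) ^ \<beta> * poly (W * double_deriv (\<beta> + 2) \<alpha> (W ^ (\<beta> + 1) * Y)) ((1 - x) / 2))"
    unfolding y_def using x by (simp only: L_high_op_eq_high_op smooth_poly open_greaterThanLessThan high_op_poly greaterThanLessThan_iff)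
  moreover have "M * ((-1) ^ \<beta> * poly (W * double_deriv (\<beta> + 2) \<alpha> (W ^ (\<beta> + 1) * Y)) ((1 - x) / 2) - eigval_high \<beta> \<alpha> n * y x)
     + C_const \<beta> \<alpha> * (L2_op \<alpha> (real \<beta>) y x - eigval_2 \<alpha> (real \<beta>) n * y x) = 0"
    using arg_cong[OF eq, of "\<lambda>p. poly p ((1 - x) / 2)"]
    unfolding y_def L2_op_poly by (simp only: poly_smult poly_diff)
  ultimately show ?thesis
    by (simp only: of_real_diff[symmetric] of_real_mult[symmetric] of_real_add[symmetric] of_real_0)
qed

section \<open>The differential equation\<close>

lemma sum_low_order_terms:
  fixes c p q r :: real and u d :: "nat \<Rightarrow> real"
  assumes "N \<ge> 2"
  shows "(\<Sum>i\<le>N. (c * u i + (if i = 0 then p else 0) + (if i = 1 then q else 0)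
      + (if i = 2 then r else 0)) * d i) =
    c * (\<Sum>i\<le>N. u i * d i) + p * d 0 + q * d 1 + r * d 2"
  using assms unfolding distrib_right sum.distrib sum_distrib_left
  by (simp add: if_distrib[of "\<lambda>c. c * _"] mult.assoc cong: if_cong)

theorem corollary1p2:
  fixes \<beta> n :: nat and \<alpha> M :: real and k :: int
  assumes "\<alpha> > -1" and "M > 0"
  shows "linear_diff_op_of_order (2 * \<beta> + 4) {-1<..<1}
           (\<lambda>y x. complex_of_real M *
                    (L_high_op k \<beta> \<alpha> y x - complex_of_real (eigval_high \<beta> \<alpha> n * y x))
                + complex_of_real (C_const \<beta> \<alpha> *
                    (L2_op \<alpha> (real \<beta>) y x - eigval_2 \<alpha> (real \<beta>) n * y x)))
       \<and> (\<forall>x\<in>{-1<..<1}.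
            complex_of_real M *
              (L_high_op k \<beta> \<alpha> (jacobi_type n \<alpha> (real \<beta>) M) x
                 - complex_of_real (eigval_high \<beta> \<alpha> n * jacobi_type n \<alpha> (real \<beta>) M x))
            + complex_of_real (C_const \<beta> \<alpha> *
                (L2_op \<alpha> (real \<beta>) (jacobi_type n \<alpha> (real \<beta>) M) x
                   - eigval_2 \<alpha> (real \<beta>) n * jacobi_type n \<alpha> (real \<beta>) M x)) = 0)"
proof (intro conjI ballI)
  let ?S = "{-1<..<1::real}" and ?m = "\<beta> + 2"
  let ?C = "C_const \<beta> \<alpha>"
  have "smooth_diff_op ?S (?m + ?m) (\<lambda>x. ((x + 1) * (1 - x) powr (- \<alpha>)) * ((1 - x) powr (\<alpha> + real ?m) * (x + 1) ^ (?m - 1)))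
    (high_op ?m \<alpha>)"
    by (rule smooth_diff_op_high_op) auto
  then obtain a where lead: "a (?m + ?m) = (\<lambda>x. ((x + 1) * (1 - x) powr (- \<alpha>)) * ((1 - x) powr (\<alpha> + real ?m) * (x + 1) ^ (?m - 1)))"
    and a: "\<And>y x. smooth_fun_on ?S y \<Longrightarrow> x \<in> ?S \<Longrightarrow> high_op ?m \<alpha> y x = (\<Sum>i\<le>?m + ?m. a i x * Dx i y x)"
    unfolding smooth_diff_op_def by blast
  define b where "b i x = M * (-1) ^ \<beta> * a i x
     + (if i = 0 then - M * eigval_high \<beta> \<alpha> n - ?C * eigval_2 \<alpha> (real \<beta>) n else 0)
     + (if i = 1 then ?C * (\<alpha> - real \<beta> + (\<alpha> + real \<beta> + 2) * x) else 0)
     + (if i = 2 then ?C * (x\<^sup>2 - 1) else 0)" for i x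
  have m: "2 * \<beta> + 4 = ?m + ?m" by simp
  show "linear_diff_op_of_order (2 * \<beta> + 4) ?S
           (\<lambda>y x. complex_of_real M *
                    (L_high_op k \<beta> \<alpha> y x - complex_of_real (eigval_high \<beta> \<alpha> n * y x))
                + complex_of_real (C_const \<beta> \<alpha> *
                    (L2_op \<alpha> (real \<beta>) y x - eigval_2 \<alpha> (real \<beta>) n * y x)))"
    unfolding linear_diff_op_of_order_def m
  proof (intro exI[of _ b] conjI ballI allI impI)
    fix x assume "x \<in> ?S"
    moreover have "b (?m + ?m) x = M * (-1) ^ \<beta> * a (?m + ?m) x"
      by (simp add: b_def)
    ultimately show "b (?m + ?m) x \<noteq> 0"
      unfolding lead using \<open>M > 0\<close> by simp
  next
    fix y x assume y: "smooth_fun_on ?S y" and x: "x \<in> ?S"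
    have "(\<Sum>i\<le>?m + ?m. b i x * Dx i y x) =
      M * (-1) ^ \<beta> * (\<Sum>i\<le>?m + ?m. a i x * Dx i y x)
      + (- M * eigval_high \<beta> \<alpha> n - ?C * eigval_2 \<alpha> (real \<beta>) n) * y x
      + ?C * (\<alpha> - real \<beta> + (\<alpha> + real \<beta> + 2) * x) * Dx 1 y x
      + ?C * (x\<^sup>2 - 1) * Dx 2 y x"
      unfolding b_def by (subst sum_low_order_terms) simp_all
    also have "\<dots> = M * ((-1) ^ \<beta> * high_op ?m \<alpha> y x - eigval_high \<beta> \<alpha> n * y x) +
       ?C * (L2_op \<alpha> (real \<beta>) y x - eigval_2 \<alpha> (real \<beta>) n * y x)"
      unfolding a[OF y x] L2_op_def by (simp only: algebra_simps)
    finally show "complex_of_real M * (L_high_op k \<beta> \<alpha> y x - complex_of_real (eigval_high \<beta> \<alpha> n * y x))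
                + complex_of_real (C_const \<beta> \<alpha> *
                    (L2_op \<alpha> (real \<beta>) y x - eigval_2 \<alpha> (real \<beta>) n * y x)) =
       complex_of_real (\<Sum>i\<le>?m + ?m. b i x * Dx i y x)"
      by (simp only: L_high_op_eq_high_op[OF y x] of_real_diff of_real_mult of_real_add)
  qed
next
  fix x :: real assume x: "x \<in> {-1<..<1}"
  show "complex_of_real M *
              (L_high_op k \<beta> \<alpha> (jacobi_type n \<alpha> (real \<beta>) M) x
                 - complex_of_real (eigval_high \<beta> \<alpha> n * jacobi_type n \<alpha> (real \<beta>) M x))
            + complex_of_real (C_const \<beta> \<alpha> *
                (L2_op \<alpha> (real \<beta>) (jacobi_type n \<alpha> (real \<beta>) M) x
                   - eigval_2 \<alpha> (real \<beta>) n * jacobi_type n \<alpha> (real \<beta>) M x)) = 0"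
  proof (cases n)
    case 0
    \<comment> \<open>Degree zero has no \<open>G\<close> and \<open>\<Lambda>\<^sub>2 = 0\<close>; here \<open>y = 1\<close> and \<open>D\<close> to the power \<open>\<beta> + 2\<close> kills \<open>(x + 1) ^ (\<beta> + 1)\<close>.\<close>
    have "double_deriv (\<beta> + 2) \<alpha> (W ^ (\<beta> + 1) * 1) = 0"
    proof (rule poly_eqI)
      fix i
      have "degree (W ^ (\<beta> + 1)) \<le> \<beta> + 1"
        by (rule order_trans[OF degree_power_le]) (simp add: W_def)
      then show "coeff (double_deriv (\<beta> + 2) \<alpha> (W ^ (\<beta> + 1) * 1)) i = coeff 0 i"
        by (simp add: coeff_double_deriv coeff_eq_0 del: power_Suc)
    qed
    moreover have "eigval_high \<beta> \<alpha> 0 = 0"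
      by (simp add: eigval_high_def pochhammer_0_left)
    ultimately show ?thesis
      unfolding 0 jacobi_type_poly_0[abs_def]
      by (intro operator_equation x) (simp only: , simp add: hyp_op_def)
  next
    case (Suc \<nu>)
    show ?thesis
      unfolding Suc jacobi_type_poly_Suc[abs_def]
      using jacobi_type_coefficient_equation[OF assms(1), of M \<beta> \<nu>]
      by (intro operator_equation x) (simp only: add.assoc)
  qed
qed

end
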